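(* Let $d \geq 2$, $n \geq 1$, $\varphi(t) = \frac12 t^2$ and $w_{ij} = 1$ for all $i,j$. If $X \in \mathcal{M}$ is a critical point of $f(X) = \frac14\|X^\top X\|_F^2$ at which the Riemannian Hessian is negative semidefinite, then $\mathrm{rank}(X) < d$.
   Context: $\mathcal{M} = (\mathbb{S}^{d-1})^n$ is the set of $X \in \mathbb{R}^{d\times n}$ with unit-norm columns $x_1,\dots,x_n$, a Riemannian submanifold of $\mathbb{R}^{d\times n}$ with the Frobenius metric; gradient and Hessian are Riemannian. *)

theory Defs
  imports "HOL-Analysis.Analysis"
begin

text \<open>Matrices X in R^(d x n) are of type real^'n^'d (d rows, n columns);
  column j X is the j-th column x_j. The inner product on real^'n^'d is the Frobenius one.\<close>

definition onM :: "real^'n^'d \<Rightarrow> bool" where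
  "onM X \<longleftrightarrow> (\<forall>j. norm (column j X) = 1)"

text \<open>Tangent space of the product of spheres at X.\<close>
definition tangentM :: "real^'n^'d \<Rightarrow> (real^'n^'d) set" where
  "tangentM X = {V. \<forall>j. column j X \<bullet> column j V = 0}"

text \<open>Orthogonal projection onto the tangent space (columnwise), defined for every X.\<close>
definition projM :: "real^'n^'d \<Rightarrow> real^'n^'d \<Rightarrow> real^'n^'d" where
  "projM X Z = (\<chi> i j. Z$i$j - (column j X \<bullet> column j Z) * X$i$j)"

text \<open>Euclidean gradient w.r.t. the Frobenius inner product.\<close>
definition egrad :: "(real^'n^'d \<Rightarrow> real) \<Rightarrow> real^'n^'d \<Rightarrow> real^'n^'d" where
  "egrad f X = (THE G. (f has_derivative (\<lambda>H. G \<bullet> H)) (at X))"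

text \<open>Riemannian gradient on the Riemannian submanifold: projection of the Euclidean gradient.\<close>
definition rgrad :: "(real^'n^'d \<Rightarrow> real) \<Rightarrow> real^'n^'d \<Rightarrow> real^'n^'d" where
  "rgrad f X = projM X (egrad f X)"

text \<open>Riemannian Hessian of a Riemannian submanifold: Hess f(X)[V] = Proj_X (D G(X)[V]),
  where G(Y) = Proj_Y(egrad f Y) is a smooth extension of the Riemannian gradient.\<close>
definition rhess :: "(real^'n^'d \<Rightarrow> real) \<Rightarrow> real^'n^'d \<Rightarrow> real^'n^'d \<Rightarrow> real^'n^'d" where
  "rhess f X V = projM X (frechet_derivative (rgrad f) (at X) V)"

definition crit_point :: "(real^'n^'d \<Rightarrow> real) \<Rightarrow> real^'n^'d \<Rightarrow> bool" where
  "crit_point f X \<longleftrightarrow> onM X \<and> rgrad f X = 0"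

definition hess_nsd :: "(real^'n^'d \<Rightarrow> real) \<Rightarrow> real^'n^'d \<Rightarrow> bool" where
  "hess_nsd f X \<longleftrightarrow> (\<forall>V\<in>tangentM X. rhess f X V \<bullet> V \<le> 0)"

text \<open>f(X) = 1/4 ||X^T X||_F^2 (i.e. phi(t) = t^2/2, w_ij = 1).\<close>
definition fquart :: "real^'n^'d \<Rightarrow> real" where
  "fquart X = (1/4) * (norm (transpose X ** X))^2"

end

theory Submission
  imports Defs
begin

text \<open>At a critical point the columns are eigenvectors of the frame operator
  \<open>S = X X\<^sup>T\<close>: \<open>S x\<^sub>k = \<mu>\<^sub>k x\<^sub>k\<close> with \<open>\<mu>\<^sub>k = x\<^sub>k\<^sup>T X X\<^sup>T X e\<^sub>k\<close>. Take \<open>j\<close> with \<open>\<mu>\<^sub>j\<close> minimal and a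
  tangent direction \<open>V = w e\<^sub>j\<^sup>T\<close> with \<open>w \<bottom> x\<^sub>j\<close>, \<open>w \<noteq> 0\<close>; then
  \<open>\<langle>Hess f(X)[V], V\<rangle> = w\<^sup>T S w + (1 - \<mu>\<^sub>j) \<parallel>w\<parallel>\<^sup>2\<close>. If \<open>X\<close> had rank \<open>d\<close>, the columns would span
  \<open>\<real>\<^sup>d\<close>, so every eigenvalue of \<open>S\<close> is some \<open>\<mu>\<^sub>k \<ge> \<mu>\<^sub>j\<close>, whence \<open>w\<^sup>T S w \<ge> \<mu>\<^sub>j \<parallel>w\<parallel>\<^sup>2\<close> and the
  Hessian is positive at \<open>V\<close>.\<close>

lemma bounded_bilinear_matrix_mult:
  "bounded_bilinear ((**) :: real^'n^'m \<Rightarrow> real^'p^'n \<Rightarrow> real^'p^'m)"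
  unfolding bilinear_conv_bounded_bilinear[symmetric] bilinear_def
  by (auto intro!: linearI simp: matrix_add_ldistrib matrix_scalar_ac scalar_matrix_assoc
        vec_eq_iff matrix_matrix_mult_def sum.distrib algebra_simps sum_distrib_left)

lemma bounded_linear_transpose: "bounded_linear (transpose :: real^'n^'m \<Rightarrow> real^'m^'n)"
  by (rule linear_conv_bounded_linear[THEN iffD1])
    (auto intro!: linearI simp: vec_eq_iff transpose_def)

lemma inner_transpose: "transpose A \<bullet> transpose B = A \<bullet> (B :: real^'n^'m)"
  unfolding inner_vec_def transpose_def by (simp, rule sum.swap)

lemma inner_matrix_mult_left:
  "(A ** B) \<bullet> C = B \<bullet> (transpose A ** C)" for A :: "real^'n^'m" and C :: "real^'p^'m"
proof -
  have "(A ** B) \<bullet> C = (\<Sum>i\<in>UNIV. \<Sum>j\<in>UNIV. \<Sum>k\<in>UNIV. A$i$k * B$k$j * C$i$j)"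
    by (simp add: inner_vec_def matrix_matrix_mult_def sum_distrib_right)
  also have "\<dots> = (\<Sum>k\<in>UNIV. \<Sum>j\<in>UNIV. \<Sum>i\<in>UNIV. A$i$k * B$k$j * C$i$j)"
    by (subst sum.swap, subst (2) sum.swap, rule sum.cong[OF refl], rule sum.swap)
  also have "\<dots> = B \<bullet> (transpose A ** C)"
    by (simp add: inner_vec_def matrix_matrix_mult_def transpose_def sum_distrib_left mult_ac)
  finally show ?thesis .
qed

lemma transpose_mult_nth: "(transpose A ** B)$k$j = column k A \<bullet> column j (B :: real^'p^'m)"
  for A :: "real^'n^'m"
  by (simp add: matrix_matrix_mult_def transpose_def column_def inner_vec_def)

lemma inner_matrix_mult_columns:
  "(A ** B) \<bullet> C = (\<Sum>k\<in>UNIV. \<Sum>j\<in>UNIV. B$k$j * (column k A \<bullet> column j C))"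
  for A :: "real^'n^'m" and C :: "real^'p^'m"
  unfolding inner_matrix_mult_left inner_vec_def[of B] by (simp add: inner_vec_def[of "B$k" for k] transpose_mult_nth)

definition column_inner :: "real^'n^'d \<Rightarrow> real^'n^'d \<Rightarrow> real^'n" where
  "column_inner Y Z = (\<chi> j. column j Y \<bullet> column j Z)"

definition column_scale :: "real^'n \<Rightarrow> real^'n^'d \<Rightarrow> real^'n^'d" where
  "column_scale c Y = (\<chi> i j. c$j * Y$i$j)"

lemma bounded_bilinear_column_inner: "bounded_bilinear column_inner"
  unfolding bilinear_conv_bounded_bilinear[symmetric] bilinear_def
  by (auto intro!: linearI simp: column_inner_def vec_eq_iff column_def inner_vec_def
      sum.distrib algebra_simps sum_distrib_left)

lemma bounded_bilinear_column_scale: "bounded_bilinear column_scale"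
  unfolding bilinear_conv_bounded_bilinear[symmetric] bilinear_def
  by (auto intro!: linearI simp: column_scale_def vec_eq_iff algebra_simps)

lemma projM_eq: "projM X Z = Z - column_scale (column_inner X Z) X"
  by (simp add: projM_def column_scale_def column_inner_def vec_eq_iff)

lemma inner_column_scale:
  "column_scale c Y \<bullet> Z = (\<Sum>j\<in>UNIV. c$j * (column j Y \<bullet> column j (Z :: real^'n^'d)))"
proof -
  have "column_scale c Y \<bullet> Z = (\<Sum>i\<in>UNIV. \<Sum>j\<in>UNIV. c$j * (Y$i$j * Z$i$j))"
    by (simp add: column_scale_def inner_vec_def mult.assoc)
  also have "\<dots> = (\<Sum>j\<in>UNIV. c$j * (column j Y \<bullet> column j Z))"
    by (subst sum.swap) (simp add: column_def inner_vec_def sum_distrib_left)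
  finally show ?thesis .
qed

lemma inner_column_scale_tangentM: "V \<in> tangentM X \<Longrightarrow> column_scale c X \<bullet> V = 0"
  by (simp add: inner_column_scale tangentM_def)

lemma inner_projM_tangentM: "V \<in> tangentM X \<Longrightarrow> projM X Z \<bullet> V = Z \<bullet> V"
  by (simp add: projM_eq inner_diff_left inner_column_scale_tangentM)

lemma egrad_eqI:
  assumes "(f has_derivative (\<lambda>H. G \<bullet> H)) (at X)"
  shows "egrad f X = G"
  unfolding egrad_def
proof (rule the_equality)
  fix G' assume "(f has_derivative (\<lambda>H. G' \<bullet> H)) (at X)"
  then have "(\<lambda>H. G' \<bullet> H) = (\<lambda>H. G \<bullet> H)"
    using assms by (rule has_derivative_unique)
  then have "(G' - G) \<bullet> (G' - G) = 0"
    by (metis inner_diff_left right_minus_eq)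
  then show "G' = G" by simp
qed (rule assms)

lemma has_derivative_gram:
  "((\<lambda>Y. transpose Y ** Y) has_derivative (\<lambda>H. transpose Y ** H + transpose H ** Y)) (at Y)"
  for Y :: "real^'n^'d"
  by (rule bounded_bilinear.FDERIV[OF bounded_bilinear_matrix_mult
        bounded_linear.has_derivative[OF bounded_linear_transpose has_derivative_ident]
        has_derivative_ident])

lemma egrad_fquart: "egrad fquart Y = Y ** (transpose Y ** Y)"
proof (rule egrad_eqI)
  let ?M = "transpose Y ** Y"
  have "(fquart has_derivative (\<lambda>H. (1/4) * (?M \<bullet> (transpose Y ** H + transpose H ** Y)
        + (transpose Y ** H + transpose H ** Y) \<bullet> ?M))) (at Y)"
    unfolding fquart_def power2_norm_eq_inner
    by (intro has_derivative_mult_right bounded_bilinear.FDERIV[OF bounded_bilinear_inner]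
        has_derivative_gram)
  moreover have "(transpose H ** Y) \<bullet> ?M = (transpose Y ** H) \<bullet> ?M" for H
    using inner_transpose[of "transpose H ** Y" ?M] by (simp add: matrix_transpose_mul)
  moreover have "(transpose Y ** H) \<bullet> ?M = (Y ** ?M) \<bullet> H" for H
    by (simp add: inner_matrix_mult_left inner_commute)
  ultimately show "(fquart has_derivative (\<lambda>H. (Y ** ?M) \<bullet> H)) (at Y)"
    by (simp add: inner_add_left inner_add_right inner_commute[of ?M])
qed

lemma rgrad_fquart:
  "rgrad fquart = (\<lambda>Y. Y ** (transpose Y ** Y) - column_scale (column_inner Y (Y ** (transpose Y ** Y))) Y)"
  by (simp add: fun_eq_iff rgrad_def egrad_fquart projM_eq)

lemma has_derivative_egrad_fquart:
  "((\<lambda>Y. Y ** (transpose Y ** Y)) has_derivative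
     (\<lambda>H. Y ** (transpose Y ** H + transpose H ** Y) + H ** (transpose Y ** Y))) (at Y)"
  for Y :: "real^'n^'d"
  by (rule bounded_bilinear.FDERIV[OF bounded_bilinear_matrix_mult has_derivative_ident
        has_derivative_gram])

lemma rhess_fquart_inner_tangentM:
  fixes X V :: "real^'n^'d"
  assumes "V \<in> tangentM X"
  shows "rhess fquart X V \<bullet> V =
    (X ** (transpose X ** V + transpose V ** X) + V ** (transpose X ** X)
      - column_scale (column_inner X (X ** (transpose X ** X))) V) \<bullet> V"
proof -
  let ?P = "\<lambda>Y. Y ** (transpose Y ** Y)"
  let ?DP = "\<lambda>H. X ** (transpose X ** H + transpose H ** X) + H ** (transpose X ** X)"
  have "(rgrad fquart has_derivative (\<lambda>H. ?DP H - (column_scale (column_inner X (?P X)) H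
      + column_scale (column_inner X (?DP H) + column_inner H (?P X)) X))) (at X)"
    unfolding rgrad_fquart
    by (intro has_derivative_diff has_derivative_egrad_fquart
        bounded_bilinear.FDERIV[OF bounded_bilinear_column_scale _ has_derivative_ident]
        bounded_bilinear.FDERIV[OF bounded_bilinear_column_inner has_derivative_ident])
  then have "frechet_derivative (rgrad fquart) (at X) V = ?DP V - (column_scale (column_inner X (?P X)) V
      + column_scale (column_inner X (?DP V) + column_inner V (?P X)) X)"
    by (simp add: frechet_derivative_at[symmetric])
  then show ?thesis
    using assms by (simp add: rhess_def inner_projM_tangentM inner_diff_left inner_add_left
        inner_column_scale_tangentM)
qed

definition single_column :: "'n \<Rightarrow> real^'d \<Rightarrow> real^'n^'d" where
  "single_column j w = (\<chi> i k. if k = j then w$i else 0)"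

lemma column_single_column: "column k (single_column j w) = (if k = j then w else 0)"
  by (simp add: single_column_def column_def vec_eq_iff)

lemma single_column_in_tangentM: "column j X \<bullet> w = 0 \<Longrightarrow> single_column j w \<in> tangentM X"
  by (simp add: tangentM_def column_single_column)

lemma inner_single_column_left: "column k (single_column j w) \<bullet> y = (if k = j then w \<bullet> y else 0)"
  by (simp add: column_single_column)

lemma inner_single_column_right: "y \<bullet> column k (single_column j w) = (if k = j then y \<bullet> w else 0)"
  by (simp add: column_single_column)

lemma rhess_fquart_single_column:
  fixes X :: "real^'n^'d"
  assumes "onM X" and "column j X \<bullet> w = 0"
  shows "rhess fquart X (single_column j w) \<bullet> single_column j w =
    (\<Sum>l\<in>UNIV. (column l X \<bullet> w)\<^sup>2) + (1 - column_inner X (X ** (transpose X ** X)) $ j) * (w \<bullet> w)"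
proof -
  let ?V = "single_column j w"
  have if_mult: "c * (if P then b else 0) = (if P then c * b else 0)"
    "(if P then b else 0) * c = (if P then b * c else 0)" for c b :: real and P
    by simp_all
  note simps = inner_matrix_mult_columns transpose_mult_nth inner_single_column_left
    inner_single_column_right if_mult
  have unit: "column j X \<bullet> column j X = 1"
    using assms(1) by (simp add: onM_def power2_norm_eq_inner[symmetric])
  have "(X ** (transpose X ** ?V)) \<bullet> ?V = (\<Sum>l\<in>UNIV. (column l X \<bullet> w)\<^sup>2)"
    by (simp add: simps power2_eq_square)
  moreover have "(X ** (transpose ?V ** X)) \<bullet> ?V = 0"
    using assms(2) inner_commute[of w "column j X"] by (simp add: simps)
  moreover have "(?V ** (transpose X ** X)) \<bullet> ?V = w \<bullet> w"
    using unit by (simp add: simps)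
  moreover have "column_scale c ?V \<bullet> ?V = c $ j * (w \<bullet> w)" for c
    by (simp add: inner_column_scale simps)
  ultimately show ?thesis
    using assms(2) by (simp add: rhess_fquart_inner_tangentM single_column_in_tangentM
        matrix_add_ldistrib inner_diff_left inner_add_left algebra_simps)
qed

lemma crit_point_fquart_eigen:
  fixes X :: "real^'n^'d"
  assumes "crit_point fquart X"
  shows "(\<Sum>l\<in>UNIV. (column l X \<bullet> column k X) *\<^sub>R column l X)
    = column_inner X (X ** (transpose X ** X)) $ k *\<^sub>R column k X"
proof -
  let ?c = "column_inner X (X ** (transpose X ** X))"
  have "X ** (transpose X ** X) = column_scale ?c X"
    using assms by (simp add: crit_point_def rgrad_fquart)
  then have "(X ** (transpose X ** X))$i$k = column_scale ?c X $i$k" for i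
    by (rule arg_cong)
  then have "(X ** (transpose X ** X))$i$k = ?c$k * X$i$k" for i
    by (simp only: column_scale_def vec_lambda_beta)
  moreover have "(X ** (transpose X ** X))$i$k = (\<Sum>l\<in>UNIV. (column l X \<bullet> column k X) * X$i$l)" for i
    unfolding matrix_matrix_mult_def[of X "transpose X ** X"]
    by (simp add: transpose_mult_nth mult.commute)
  ultimately show ?thesis
    by (simp add: vec_eq_iff sum_component column_def)
qed

lemma eigenvalues_eq_if_not_orthogonal:
  fixes x :: "'n::finite \<Rightarrow> 'a::real_inner"
  assumes eigen: "\<And>k. (\<Sum>l\<in>UNIV. (x l \<bullet> x k) *\<^sub>R x l) = \<mu> k *\<^sub>R x k"
  shows "\<mu> k * (x j \<bullet> x k) = \<mu> j * (x j \<bullet> x k)"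
proof -
  have "\<mu> k * (x j \<bullet> x k) = x j \<bullet> (\<mu> k *\<^sub>R x k)"
    by simp
  also have "\<dots> = (\<Sum>l\<in>UNIV. (x l \<bullet> x k) * (x j \<bullet> x l))"
    by (simp add: eigen[symmetric] inner_sum_right)
  also have "\<dots> = (\<Sum>l\<in>UNIV. (x l \<bullet> x j) * (x k \<bullet> x l))"
    by (simp add: inner_commute mult.commute)
  also have "\<dots> = x k \<bullet> (\<mu> j *\<^sub>R x j)"
    by (simp add: eigen[symmetric] inner_sum_right)
  also have "\<dots> = \<mu> j * (x j \<bullet> x k)"
    by (simp add: inner_commute)
  finally show ?thesis .
qed

lemma frame_operator_ge_min_eigenvalue:
  fixes x :: "'n::finite \<Rightarrow> 'a::real_inner"
  assumes eigen: "\<And>k. (\<Sum>l\<in>UNIV. (x l \<bullet> x k) *\<^sub>R x l) = \<mu> k *\<^sub>R x k"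
    and min: "\<And>k. m \<le> \<mu> k"
    and w: "w = (\<Sum>k\<in>UNIV. a k *\<^sub>R x k)"
  shows "m * (w \<bullet> w) \<le> (\<Sum>l\<in>UNIV. (x l \<bullet> w)\<^sup>2)"
proof -
  \<comment> \<open>Non-orthogonal \<open>x\<^sub>j, x\<^sub>k\<close> share their eigenvalue, so the excess
    \<open>\<Sum>\<^sub>l (x\<^sub>l \<bullet> w)\<^sup>2 - m \<parallel>w\<parallel>\<^sup>2\<close> is the square norm of \<open>u = \<Sum>\<^sub>k a\<^sub>k \<surd>(\<mu>\<^sub>k - m) x\<^sub>k\<close>.\<close>
  define s where "s k = sqrt (\<mu> k - m)" for k
  define u where "u = (\<Sum>k\<in>UNIV. (a k * s k) *\<^sub>R x k)"
  have "(\<Sum>l\<in>UNIV. (x l \<bullet> w) *\<^sub>R x l) = (\<Sum>l\<in>UNIV. \<Sum>k\<in>UNIV. (a k * (x l \<bullet> x k)) *\<^sub>R x l)"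
    by (simp add: w inner_sum_right scaleR_sum_left)
  also have "\<dots> = (\<Sum>k\<in>UNIV. \<Sum>l\<in>UNIV. (a k * (x l \<bullet> x k)) *\<^sub>R x l)"
    by (rule sum.swap)
  also have "\<dots> = (\<Sum>k\<in>UNIV. a k *\<^sub>R (\<Sum>l\<in>UNIV. (x l \<bullet> x k) *\<^sub>R x l))"
    by (simp add: scaleR_sum_right)
  also have "\<dots> = (\<Sum>k\<in>UNIV. (a k * \<mu> k) *\<^sub>R x k)"
    by (simp add: eigen)
  finally have frame: "(\<Sum>l\<in>UNIV. (x l \<bullet> w) *\<^sub>R x l) = (\<Sum>k\<in>UNIV. (a k * \<mu> k) *\<^sub>R x k)" .
  have "(\<Sum>l\<in>UNIV. (x l \<bullet> w)\<^sup>2) = w \<bullet> (\<Sum>l\<in>UNIV. (x l \<bullet> w) *\<^sub>R x l)"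
    by (simp add: inner_sum_right power2_eq_square inner_commute)
  moreover have "(\<Sum>k\<in>UNIV. (a k * m) *\<^sub>R x k) = m *\<^sub>R w"
    by (simp add: w scaleR_sum_right mult.commute)
  then have "m * (w \<bullet> w) = w \<bullet> (\<Sum>k\<in>UNIV. (a k * m) *\<^sub>R x k)"
    by simp
  ultimately have "(\<Sum>l\<in>UNIV. (x l \<bullet> w)\<^sup>2) - m * (w \<bullet> w)
      = w \<bullet> (\<Sum>k\<in>UNIV. (a k * (\<mu> k - m)) *\<^sub>R x k)"
    by (simp add: frame inner_diff_right[symmetric] sum_subtractf[symmetric] algebra_simps)
  also have "\<dots> = (\<Sum>k\<in>UNIV. \<Sum>j\<in>UNIV. a j * (a k * (\<mu> k - m)) * (x j \<bullet> x k))"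
    by (simp add: w inner_sum_right inner_sum_left sum_distrib_left mult_ac)
  also have "\<dots> = (\<Sum>k\<in>UNIV. \<Sum>j\<in>UNIV. (a j * s j) * (a k * s k) * (x j \<bullet> x k))"
  proof (intro sum.cong refl)
    fix k j
    show "a j * (a k * (\<mu> k - m)) * (x j \<bullet> x k) = (a j * s j) * (a k * s k) * (x j \<bullet> x k)"
    proof (cases "x j \<bullet> x k = 0")
      case False
      then have "\<mu> j = \<mu> k"
        using eigenvalues_eq_if_not_orthogonal[OF eigen, of k j] by simp
      then have "s j * s k = \<mu> k - m"
        using min[of k] by (simp add: s_def)
      then show ?thesis by (metis mult.assoc mult.left_commute)
    qed simp
  qed
  also have "\<dots> = u \<bullet> u"
    by (simp add: u_def inner_sum_right inner_sum_left sum_distrib_left mult.assoc mult.left_commute)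
  finally show ?thesis
    using inner_ge_zero[of u] by linarith
qed

lemma exists_nonzero_orthogonal:
  fixes v :: "'a::euclidean_space"
  assumes "DIM('a) \<ge> 2"
  shows "\<exists>w. w \<noteq> 0 \<and> v \<bullet> w = 0"
proof -
  have "dim {v} < DIM('a)"
    using assms by simp
  then obtain w where "w \<noteq> 0" "span {v} \<subseteq> {x. w \<bullet> x = 0}"
    using lowdim_subset_hyperplane by blast
  moreover have "v \<in> span {v}"
    by (simp add: span_base)
  ultimately show ?thesis
    by (metis (mono_tags) inner_commute mem_Collect_eq subsetD)
qed

theorem mainTheorem18:
  fixes X :: "real^'n^'d"
  assumes "CARD('d) \<ge> 2"
    and "onM X"
    and "crit_point fquart X"
    and "hess_nsd fquart X"
  shows "rank X < CARD('d)"
proof (rule ccontr)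
  assume "\<not> rank X < CARD('d)"
  then have "rank X = CARD('d)"
    using rank_bound[of X] by linarith
  then have "surj ((*v) X)"
    by (simp add: full_rank_surjective)
  define \<mu> where "\<mu> = column_inner X (X ** (transpose X ** X))"
  obtain j where j: "\<And>k. \<mu>$j \<le> \<mu>$k"
    using ex_min_if_finite[of "range (($) \<mu>)"] by (auto simp: not_less)
  obtain w where w: "w \<noteq> 0" "column j X \<bullet> w = 0"
    using exists_nonzero_orthogonal[of "column j X"] assms(1) by auto
  obtain a where "w = X *v a"
    using \<open>surj ((*v) X)\<close> by (metis surjD)
  then have "\<mu>$j * (w \<bullet> w) \<le> (\<Sum>l\<in>UNIV. (column l X \<bullet> w)\<^sup>2)"
    by (intro frame_operator_ge_min_eigenvalue[where \<mu>="\<lambda>k. \<mu>$k" and a="\<lambda>k. a$k"]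
        crit_point_fquart_eigen[OF assms(3), folded \<mu>_def] j)
      (simp add: matrix_mult_sum scalar_mult_eq_scaleR)
  moreover have "rhess fquart X (single_column j w) \<bullet> single_column j w
      = (\<Sum>l\<in>UNIV. (column l X \<bullet> w)\<^sup>2) + w \<bullet> w - \<mu>$j * (w \<bullet> w)"
    by (simp add: rhess_fquart_single_column[OF assms(2) w(2)] \<mu>_def left_diff_distrib)
  ultimately have "rhess fquart X (single_column j w) \<bullet> single_column j w > 0"
    using inner_gt_zero_iff[of w] w(1) by linarith
  moreover have "rhess fquart X (single_column j w) \<bullet> single_column j w \<le> 0"
    using assms(4) single_column_in_tangentM[OF w(2)] by (simp add: hess_nsd_def)
  ultimately show False by simp
qed

end
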